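(* Let $f_1,\dots,f_c$ be a regular sequence in a ring $S$ and $R=S/(f_1,\dots,f_c)$. (1) If $(d,h)$ is a strong matrix factorization with respect to $f_1,\dots,f_c$, then it is a higher matrix factorization with respect to $f_1,\dots,f_c$. (2) Let $(d,h')$ be a higher matrix factorization with respect to $f_1,\dots,f_c$. There exists a strong matrix factorization $(d,h)$ with the same filtrations $0\subseteq A_s(1)\subseteq\cdots\subseteq A_s(c)=A_s$, $s=0,1$, as $(d,h')$ (and the same $d$; so $(d,h)$ and $(d,h')$ have the same higher matrix factorization module $M=\operatorname{coker}(R\otimes d)$). If the ring $S$ is local and the higher matrix factorization $(d,h')$ is minimal, then $(d,h)$ is minimal as well.
   Context: All rings are commutative and Noetherian, all modules finitely generated. Put $R(p)=S/(f_1,\dots,f_p)$ for $0\le p\le c$. A higher matrix factorization (HMF) $(d,h)$ with respect to $f_1,\dots,f_c$ consists of: (1) finitely generated free $S$-modules $A_0,A_1$ with filtrations $0=A_s(0)\subseteq A_s(1)\subseteq\cdots\subseteq A_s(c)=A_s$ ($s=0,1$) such that each $A_s(p-1)$ is a free summand of $A_s(p)$; (2) $S$-linear maps $d:A_1\to A_0$ and $h:\bigoplus_{q=1}^cA_0(q)\to A_1$ preserving filtrations, where $\bigoplus_qA_0(q)$ is filtered by the submodules $\bigoplus_{q\le p}A_0(q)$; such that, writing $d_p:A_1(p)\to A_0(p)$ and $h_p:A_0(p)\to A_1(p)$ for the induced maps ($h_p$ is the restriction of $h$ to the $p$-th summand), $B_s(p)=A_s(p)/A_s(p-1)$ (free modules),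 and $\pi_p:A_1(p)\to B_1(p)$ for the projection, one has for all $1\le p\le c$: (a) $d_ph_p\equiv f_p\,\mathrm{Id}_{A_0(p)}$ modulo $(f_1,\dots,f_{p-1})A_0(p)$; (b) $\pi_ph_pd_p\equiv f_p\,\pi_p$ modulo $(f_1,\dots,f_{p-1})B_1(p)$. Put $M(p)=\operatorname{coker}(R(p)\otimes d_p)$; the module of $(d,h)$ is $M=M(c)$. Over a local ring with maximal ideal $\mathfrak m$, $(d,h)$ is minimal if the images of $d$ and $h$ lie in $\mathfrak m$ times their targets. The resolutions $\mathbf L(p)$ attached to a higher matrix factorization: fix splittings $A_s(p)=A_s(p-1)\oplus B_s(p)$. Let $\mathbf B(p)$ be the complex $b_p:B_1(p)\to B_0(p)$ induced by $d$ and $\psi_p:B_1(p)\to A_0(p-1)$ the component of $d_p$. Conventions: $\mathbf W[-1]_i=\mathbf W_{i+1}$ with differential $-\partial$; for $\varphi:\mathbf W[-1]\to\mathbf Y$ the mapping cone has terms $Y_i\oplus W_i$ and differential $\begin{pmatrix}\partial^Y&\varphi\\0&\partial^W\end{pmatrix}$. Set $\mathbf L(1)=\mathbf B(1)$; for $p\ge2$, given the $S$-free resolution $\mathbf L(p-1)$ of $M(p-1)$ with zeroth term $A_0(p-1)$, let $\Psi_p:\mathbf K(f_1,\dots,f_{p-1})\otimes\mathbf B(p)[-1]\to\mathbf L(p-1)$ ($\mathbf K$ the Koszul complex) be a Koszul extension of the map $\mathbf B(p)[-1]\to\mathbf L(p-1)$ induced by $\psi_p$, i.e. a map of complexes extending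 it from $\mathbf K_0\otimes\mathbf B(p)[-1]$ and vanishing on $\mathbf K\otimes B_0(p)$, and let $\mathbf L(p)$ be the mapping cone of $\Psi_p$. Each $\mathbf L(p)$ is an $S$-free resolution of $M(p)$. Writing $e_i$ for the Koszul generators, $L(p)_0=A_0(p)$, $L(p)_1=A_1(p)\oplus\bigoplus_{i<q\le p}e_iB_0(q)$, and the first differential is $d_p$ on $A_1(p)$ and multiplication by $f_i$, $e_iB_0(q)\to B_0(q)$, on the other summands. Strong matrix factorization: let $(d,h)$ be a higher matrix factorization and $M=\operatorname{coker}(R\otimes d)$ its module. $(d,h)$ is a strong matrix factorization for $M$ if for each $p$ the map $h_p$ can be extended to a homotopy $h(f_p)$ for $f_p$ at $L(p)_0=A_0(p)$ on the $S$-free resolution $\mathbf L(p)$ of $M(p)$; that is, there is a map $h(f_p):L(p)_0\to L(p)_1$ whose component $A_0(p)\to A_1(p)$ is $h_p$ and whose composite with the first differential of $\mathbf L(p)$ is $f_p\cdot\mathrm{Id}_{A_0(p)}$. *)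

theory Defs
  imports Complex_Main "HOL-Library.Function_Algebras" "HOL-Library.Product_Plus"
begin

section \<open>The base ring\<close>

text \<open>
  The ring \<open>S\<close> is a type of class \<^class>\<open>comm_ring_1\<close>; ideals are the submodules of \<open>S\<close>
  acting on itself by multiplication.
\<close>

definition noetherian_ring :: "'s::comm_ring_1 itself \<Rightarrow> bool" where
  "noetherian_ring _ \<longleftrightarrow>
     (\<forall>I::'s set. module.subspace (*) I \<longrightarrow> (\<exists>F. finite F \<and> module.span (*) F = I))"

definition maximal_ideal :: "'s::comm_ring_1 set \<Rightarrow> bool" where
  "maximal_ideal m \<longleftrightarrow> module.subspace (*) m \<and> m \<noteq> UNIV \<and>
     (\<forall>J. module.subspace (*) J \<and> m \<subseteq> J \<longrightarrow> J = m \<or> J = UNIV)"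

definition local_ring :: "'s::comm_ring_1 set \<Rightarrow> bool" where
  "local_ring m \<longleftrightarrow> maximal_ideal m \<and> (\<forall>m'. maximal_ideal m' \<longrightarrow> m' = m)"

text \<open>The ideal \<open>(f\<^sub>1, \<dots>, f\<^sub>p)\<close>; sequences are indexed from 1.\<close>

definition seq_ideal :: "(nat \<Rightarrow> 's::comm_ring_1) \<Rightarrow> nat \<Rightarrow> 's set" where
  "seq_ideal f p = module.span (*) (f ` {1..p})"

definition regular_sequence :: "(nat \<Rightarrow> 's::comm_ring_1) \<Rightarrow> nat \<Rightarrow> bool" where
  "regular_sequence f c \<longleftrightarrow>
     (\<forall>p\<in>{1..c}. \<forall>x. f p * x \<in> seq_ideal f (p - 1) \<longrightarrow> x \<in> seq_ideal f (p - 1)) \<and>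
     seq_ideal f c \<noteq> UNIV"


section \<open>Free modules and filtrations\<close>

definition fg_free :: "('s::comm_ring_1 \<Rightarrow> 'm::ab_group_add \<Rightarrow> 'm) \<Rightarrow> 'm set \<Rightarrow> bool" where
  "fg_free s N \<longleftrightarrow> (\<exists>X. finite X \<and> \<not> module.dependent s X \<and> module.span s X = N)"

definition ideal_times ::
    "('s::comm_ring_1 \<Rightarrow> 'm::ab_group_add \<Rightarrow> 'm) \<Rightarrow> 's set \<Rightarrow> 'm set \<Rightarrow> 'm set" where
  "ideal_times s I N = module.span s {s r x |r x. r \<in> I \<and> x \<in> N}"

definition direct_sum_decomp ::
    "('s::comm_ring_1 \<Rightarrow> 'm::ab_group_add \<Rightarrow> 'm) \<Rightarrow> 'm set \<Rightarrow> 'm set \<Rightarrow> 'm set \<Rightarrow> bool" where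
  "direct_sum_decomp s N N1 N2 \<longleftrightarrow>
     module.subspace s N1 \<and> module.subspace s N2 \<and>
     N = {x + y |x y. x \<in> N1 \<and> y \<in> N2} \<and> N1 \<inter> N2 = {0}"

text \<open>
  A filtration \<open>0 = A(0) \<subseteq> A(1) \<subseteq> \<dots> \<subseteq> A(c) = A\<close> of the whole module \<open>A\<close> (the type \<open>'m\<close>),
  where each \<open>A(p-1)\<close> is a free summand of the free module \<open>A(p)\<close>. The complement \<open>C\<close> is
  isomorphic to \<open>B(p) = A(p)/A(p-1)\<close>, which is required to be free as well.
\<close>

definition free_filtration ::
    "('s::comm_ring_1 \<Rightarrow> 'm::ab_group_add \<Rightarrow> 'm) \<Rightarrow> nat \<Rightarrow> (nat \<Rightarrow> 'm set) \<Rightarrow> bool" where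
  "free_filtration s c A \<longleftrightarrow>
     A 0 = {0} \<and> A c = UNIV \<and> (\<forall>p\<le>c. fg_free s (A p)) \<and>
     (\<forall>p\<in>{1..c}. \<exists>C. fg_free s C \<and> direct_sum_decomp s (A p) (A (p - 1)) C)"

text \<open>A choice of splittings \<open>A(p) = A(p-1) \<oplus> B(p)\<close>; here \<open>B(p)\<close> is a submodule of \<open>A(p)\<close>.\<close>

definition splitting ::
    "('s::comm_ring_1 \<Rightarrow> 'm::ab_group_add \<Rightarrow> 'm) \<Rightarrow> nat \<Rightarrow> (nat \<Rightarrow> 'm set) \<Rightarrow> (nat \<Rightarrow> 'm set) \<Rightarrow> bool"
  where
  "splitting s c A B \<longleftrightarrow> (\<forall>p\<in>{1..c}. direct_sum_decomp s (A p) (A (p - 1)) (B p))"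

definition linear_between ::
    "('s::comm_ring_1 \<Rightarrow> 'm::ab_group_add \<Rightarrow> 'm) \<Rightarrow> ('s \<Rightarrow> 'n::ab_group_add \<Rightarrow> 'n) \<Rightarrow>
     'm set \<Rightarrow> 'n set \<Rightarrow> ('m \<Rightarrow> 'n) \<Rightarrow> bool" where
  "linear_between s s' N N' g \<longleftrightarrow>
     g ` N \<subseteq> N' \<and> (\<forall>x\<in>N. \<forall>y\<in>N. g (x + y) = g x + g y) \<and> (\<forall>r. \<forall>x\<in>N. g (s r x) = s' r (g x))"

text \<open>
  The direct sum \<open>A(1) \<oplus> \<dots> \<oplus> A(p)\<close>, as families supported on \<open>{1..p}\<close>; for \<open>p \<le> c\<close> it is the
  \<open>p\<close>-th filtration step of \<open>A(1) \<oplus> \<dots> \<oplus> A(c)\<close>.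
\<close>

definition dsum :: "nat \<Rightarrow> (nat \<Rightarrow> 'm::ab_group_add set) \<Rightarrow> (nat \<Rightarrow> 'm) set" where
  "dsum p A = {x. (\<forall>q\<in>{1..p}. x q \<in> A q) \<and> (\<forall>q. q \<notin> {1..p} \<longrightarrow> x q = 0)}"

definition fun_scale :: "('s \<Rightarrow> 'm \<Rightarrow> 'm) \<Rightarrow> 's \<Rightarrow> ('i \<Rightarrow> 'm) \<Rightarrow> 'i \<Rightarrow> 'm" where
  "fun_scale s r x = (\<lambda>i. s r (x i))"


section \<open>Higher matrix factorizations\<close>

text \<open>
  The modules \<open>A\<^sub>0\<close>, \<open>A\<^sub>1\<close> are the types \<open>'a\<close>, \<open>'b\<close> with scalar multiplications \<open>s0\<close>, \<open>s1\<close>;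
  the data consist of the filtrations and the filtration-preserving maps \<open>d\<close> and \<open>h\<close>.
\<close>

definition factorization_data ::
    "nat \<Rightarrow> ('s::comm_ring_1 \<Rightarrow> 'a::ab_group_add \<Rightarrow> 'a) \<Rightarrow> ('s \<Rightarrow> 'b::ab_group_add \<Rightarrow> 'b) \<Rightarrow>
     (nat \<Rightarrow> 'a set) \<Rightarrow> (nat \<Rightarrow> 'b set) \<Rightarrow> ('b \<Rightarrow> 'a) \<Rightarrow> ((nat \<Rightarrow> 'a) \<Rightarrow> 'b) \<Rightarrow> bool" where
  "factorization_data c s0 s1 A0 A1 d h \<longleftrightarrow>
     module s0 \<and> module s1 \<and> free_filtration s0 c A0 \<and> free_filtration s1 c A1 \<and>
     module_hom s1 s0 d \<and> (\<forall>p\<le>c. d ` A1 p \<subseteq> A0 p) \<and>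
     linear_between (fun_scale s0) s1 (dsum c A0) UNIV h \<and> (\<forall>p\<le>c. h ` dsum p A0 \<subseteq> A1 p)"

text \<open>The restriction \<open>h\<^sub>p\<close> of \<open>h\<close> to the \<open>p\<close>-th summand \<open>A\<^sub>0(p)\<close>.\<close>

definition hcomp :: "((nat \<Rightarrow> 'a::ab_group_add) \<Rightarrow> 'b) \<Rightarrow> nat \<Rightarrow> 'a \<Rightarrow> 'b" where
  "hcomp h p a = h (0(p := a))"

text \<open>
  In the last condition, congruence modulo \<open>(f\<^sub>1, \<dots>, f\<^sub>p\<^sub>-\<^sub>1) B\<^sub>1(p)\<close> after applying the projection
  \<open>\<pi>\<^sub>p : A\<^sub>1(p) \<rightarrow> B\<^sub>1(p) = A\<^sub>1(p)/A\<^sub>1(p-1)\<close> is congruence in \<open>A\<^sub>1(p)\<close> modulo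
  \<open>A\<^sub>1(p-1) + (f\<^sub>1, \<dots>, f\<^sub>p\<^sub>-\<^sub>1) A\<^sub>1(p)\<close>.
\<close>

definition higher_matrix_factorization ::
    "(nat \<Rightarrow> 's) \<Rightarrow> nat \<Rightarrow> ('s::comm_ring_1 \<Rightarrow> 'a::ab_group_add \<Rightarrow> 'a) \<Rightarrow>
     ('s \<Rightarrow> 'b::ab_group_add \<Rightarrow> 'b) \<Rightarrow>
     (nat \<Rightarrow> 'a set) \<Rightarrow> (nat \<Rightarrow> 'b set) \<Rightarrow> ('b \<Rightarrow> 'a) \<Rightarrow> ((nat \<Rightarrow> 'a) \<Rightarrow> 'b) \<Rightarrow> bool" where
  "higher_matrix_factorization f c s0 s1 A0 A1 d h \<longleftrightarrow>
     factorization_data c s0 s1 A0 A1 d h \<and>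
     (\<forall>p\<in>{1..c}.
        (\<forall>a\<in>A0 p. d (hcomp h p a) - s0 (f p) a \<in> ideal_times s0 (seq_ideal f (p - 1)) (A0 p)) \<and>
        (\<forall>x\<in>A1 p. hcomp h p (d x) - s1 (f p) x
           \<in> {y + z |y z. y \<in> A1 (p - 1) \<and> z \<in> ideal_times s1 (seq_ideal f (p - 1)) (A1 p)}))"

definition minimal_factorization ::
    "'s set \<Rightarrow> nat \<Rightarrow> ('s::comm_ring_1 \<Rightarrow> 'a::ab_group_add \<Rightarrow> 'a) \<Rightarrow>
     ('s \<Rightarrow> 'b::ab_group_add \<Rightarrow> 'b) \<Rightarrow>
     (nat \<Rightarrow> 'a set) \<Rightarrow> ('b \<Rightarrow> 'a) \<Rightarrow> ((nat \<Rightarrow> 'a) \<Rightarrow> 'b) \<Rightarrow> bool" where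
  "minimal_factorization m c s0 s1 A0 d h \<longleftrightarrow>
     range d \<subseteq> ideal_times s0 m UNIV \<and> h ` dsum c A0 \<subseteq> ideal_times s1 m UNIV"


section \<open>Strong matrix factorizations\<close>

text \<open>
  The beginning \<open>L(p)\<^sub>1 \<rightarrow> L(p)\<^sub>0 = A\<^sub>0(p)\<close> of the resolution \<open>\<^bold>L(p)\<close>. The iterated mapping cone
  construction gives \<open>L(p)\<^sub>1 = A\<^sub>1(p) \<oplus> (\<Oplus> i<q\<le>p. e\<^sub>i B\<^sub>0(q))\<close>; the element
  \<open>x + (\<Sum> i<q\<le>p. e\<^sub>i u\<^sub>i\<^sub>q)\<close> is represented by \<open>(x, u)\<close> with \<open>u (i, q) = u\<^sub>i\<^sub>q\<close>. Since the Koszul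
  extensions vanish on \<open>\<^bold>K \<otimes> B\<^sub>0(q)\<close>, the first differential does not depend on their choice.
\<close>

definition L1_carrier ::
    "(nat \<Rightarrow> 'b set) \<Rightarrow> (nat \<Rightarrow> 'a set) \<Rightarrow> nat \<Rightarrow> ('b \<times> (nat \<times> nat \<Rightarrow> 'a::ab_group_add)) set" where
  "L1_carrier A1 B0 p = {(x, u). x \<in> A1 p \<and>
     (\<forall>i q. if 1 \<le> i \<and> i < q \<and> q \<le> p then u (i, q) \<in> B0 q else u (i, q) = 0)}"

definition L1_scale ::
    "('s \<Rightarrow> 'a \<Rightarrow> 'a) \<Rightarrow> ('s \<Rightarrow> 'b \<Rightarrow> 'b) \<Rightarrow> 's \<Rightarrow> 'b \<times> (nat \<times> nat \<Rightarrow> 'a) \<Rightarrow> 'b \<times> (nat \<times> nat \<Rightarrow> 'a)"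
  where
  "L1_scale s0 s1 r = (\<lambda>(x, u). (s1 r x, fun_scale s0 r u))"

definition L1_diff ::
    "(nat \<Rightarrow> 's) \<Rightarrow> ('s \<Rightarrow> 'a \<Rightarrow> 'a) \<Rightarrow> ('b \<Rightarrow> 'a) \<Rightarrow> nat \<Rightarrow>
     'b \<times> (nat \<times> nat \<Rightarrow> 'a::ab_group_add) \<Rightarrow> 'a" where
  "L1_diff f s0 d p = (\<lambda>(x, u). d x + (\<Sum>q=1..p. \<Sum>i=1..<q. s0 (f i) (u (i, q))))"

text \<open>
  Whether \<open>\<^bold>L(p)\<close> is attached to a higher matrix factorization depends only on \<open>d\<close> and the
  filtrations. So the definition asks that \<open>d\<close> be the differential of some higher matrix
  factorization (with module \<open>M = coker (R \<otimes> d)\<close>) and that the \<open>h\<^sub>p\<close> extend to homotopies on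
  the \<open>\<^bold>L(p)\<close>, but it does not presuppose that \<open>(d, h)\<close> itself is a higher matrix factorization;
  demanding the latter outright would give an equivalent notion over a regular sequence. The
  parameter \<open>B0\<close> is the chosen splitting of the filtration of \<open>A\<^sub>0\<close>.
\<close>

definition strong_matrix_factorization ::
    "(nat \<Rightarrow> 's) \<Rightarrow> nat \<Rightarrow> ('s::comm_ring_1 \<Rightarrow> 'a::ab_group_add \<Rightarrow> 'a) \<Rightarrow>
     ('s \<Rightarrow> 'b::ab_group_add \<Rightarrow> 'b) \<Rightarrow> (nat \<Rightarrow> 'a set) \<Rightarrow> (nat \<Rightarrow> 'b set) \<Rightarrow> (nat \<Rightarrow> 'a set) \<Rightarrow>
     ('b \<Rightarrow> 'a) \<Rightarrow> ((nat \<Rightarrow> 'a) \<Rightarrow> 'b) \<Rightarrow> bool" where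
  "strong_matrix_factorization f c s0 s1 A0 A1 B0 d h \<longleftrightarrow>
     factorization_data c s0 s1 A0 A1 d h \<and>
     (\<exists>h'. higher_matrix_factorization f c s0 s1 A0 A1 d h') \<and>
     (\<forall>p\<in>{1..c}. \<exists>H.
        linear_between s0 (L1_scale s0 s1) (A0 p) (L1_carrier A1 B0 p) H \<and>
        (\<forall>a\<in>A0 p. fst (H a) = hcomp h p a \<and> L1_diff f s0 d p (H a) = s0 (f p) a))"

end

theory Submission
  imports Defs
begin

text \<open>
  Write \<open>I\<^sub>p = (f\<^sub>1, \<dots>, f\<^sub>p)\<close>. Both parts can be read off the first differential of \<open>\<^bold>L(p)\<close>,
  whose image is \<open>d A\<^sub>1(p) + (\<Sum>q\<le>p. I\<^sub>q\<^sub>-\<^sub>1 B\<^sub>0(q))\<close>.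

  For the first part, the conceptual reason is exactness of \<open>\<^bold>L(p)\<close> in degree 1: if \<open>d x\<close> lies in
  \<open>I\<^sub>p\<^sub>-\<^sub>1 A\<^sub>0(p)\<close>, then \<open>\<pi>\<^sub>p x\<close> lies in \<open>I\<^sub>p\<^sub>-\<^sub>1 B\<^sub>1(p)\<close>. This consequence of exactness can be had directly
  (lemma \<open>boundary_in_ideal_imp_in_ideal\<close>): a factorization \<open>h'\<close> with the same \<open>d\<close> gives
  \<open>f\<^sub>p \<pi>\<^sub>p x \<equiv> \<pi>\<^sub>p h'\<^sub>p d x \<equiv> 0\<close> modulo \<open>I\<^sub>p\<^sub>-\<^sub>1 B\<^sub>1(p)\<close>, and \<open>f\<^sub>p\<close> is a nonzerodivisor on the free
  \<open>S/I\<^sub>p\<^sub>-\<^sub>1\<close>-module \<open>B\<^sub>1(p)/I\<^sub>p\<^sub>-\<^sub>1 B\<^sub>1(p)\<close>. Applied to \<open>h\<^sub>p d x - f\<^sub>p x\<close>, it turns the homotopy identity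
  \<open>d h\<^sub>p \<equiv> f\<^sub>p\<close> into the second congruence of a higher matrix factorization.

  For the second part, the modules \<open>A\<^sub>0(p)\<close> are free, so it is enough to see that \<open>f\<^sub>p A\<^sub>0(p)\<close> lies in
  the image of the first differential; then \<open>f\<^sub>p\<close> lifts through it. By induction on \<open>p\<close> the same is true
  of every \<open>f\<^sub>i\<close> with \<open>i \<le> p\<close> (lemma \<open>homotopy_image_contains_multiples\<close>): for \<open>i < p\<close>, the part
  \<open>f\<^sub>i A\<^sub>0(p-1)\<close> is covered by the previous step and \<open>f\<^sub>i B\<^sub>0(p)\<close> by the summand \<open>e\<^sub>i B\<^sub>0(p)\<close>; and
  \<open>f\<^sub>p a\<close> differs from \<open>d h'\<^sub>p a\<close> by an element of \<open>I\<^sub>p\<^sub>-\<^sub>1 A\<^sub>0(p)\<close>. All the components in \<open>A\<^sub>1\<close> that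
  occur in this argument lie in the submodule \<open>im h'\<close>, so \<open>h\<close> can be chosen with \<open>im h \<subseteq> im h'\<close>, and minimality
  is inherited.
\<close>

section \<open>Ideals acting on free modules\<close>

lemma module_mult: "module ((*) :: 's::comm_ring_1 \<Rightarrow> 's \<Rightarrow> 's)"
  by unfold_locales (auto simp: algebra_simps)

lemma fg_free_subspace:
  assumes "module s" "fg_free s N"
  shows "module.subspace s N"
  using assms module.subspace_span unfolding fg_free_def by blast

text \<open>
  To bound \<open>I\<^sub>p N\<close> it is enough to multiply by the generators: the scalars that carry a given
  element into a submodule form an ideal.
\<close>

lemma ideal_times_seq_ideal_least:
  assumes s: "module s" and W: "module.subspace s W"
    and gen: "\<And>i a. i \<in> {1..p} \<Longrightarrow> a \<in> N \<Longrightarrow> s (f i) a \<in> W"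
  shows "ideal_times s (seq_ideal f p) N \<subseteq> W"
proof -
  interpret module s by (fact s)
  interpret R: module "(*) :: 'a \<Rightarrow> 'a \<Rightarrow> 'a" by (fact module_mult)
  have "s r a \<in> W" if a: "a \<in> N" and r: "r \<in> seq_ideal f p" for r a
  proof -
    have "R.subspace {r. s r a \<in> W}"
      using W unfolding R.subspace_def subspace_def
      by (auto simp: scale_left_distrib simp flip: scale_scale)
    moreover have "f ` {1..p} \<subseteq> {r. s r a \<in> W}" using gen a by auto
    ultimately have "seq_ideal f p \<subseteq> {r. s r a \<in> W}"
      unfolding seq_ideal_def by (rule R.span_minimal[rotated])
    then show ?thesis using r by auto
  qed
  then show ?thesis
    unfolding ideal_times_def by (intro span_minimal W) auto
qed

lemma ideal_times_span_finite:
  assumes s: "module s" and I: "module.subspace (*) I" and X: "finite X"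
    and w: "w \<in> ideal_times s I (module.span s X)"
  obtains g where "\<And>b. b \<in> X \<Longrightarrow> g b \<in> I" "w = (\<Sum>b\<in>X. s (g b) b)"
proof -
  interpret module s by (fact s)
  interpret R: module "(*) :: 'a \<Rightarrow> 'a \<Rightarrow> 'a" by (fact module_mult)
  let ?W = "{\<Sum>b\<in>X. s (g b) b |g. \<forall>b\<in>X. g b \<in> I}"
  have "subspace ?W"
    unfolding subspace_def
  proof (intro conjI ballI allI)
    show "0 \<in> ?W"
      using R.subspace_0[OF I] by (auto intro!: exI[of _ "\<lambda>_. 0"])
  next
    fix x y assume "x \<in> ?W" "y \<in> ?W"
    then obtain g k where "\<forall>b\<in>X. g b \<in> I" "x = (\<Sum>b\<in>X. s (g b) b)"
      "\<forall>b\<in>X. k b \<in> I" "y = (\<Sum>b\<in>X. s (k b) b)" by blast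
    then show "x + y \<in> ?W"
      using R.subspace_add[OF I]
      by (auto intro!: exI[of _ "\<lambda>b. g b + k b"] simp: scale_left_distrib sum.distrib)
  next
    fix r x assume "x \<in> ?W"
    then obtain g where "\<forall>b\<in>X. g b \<in> I" "x = (\<Sum>b\<in>X. s (g b) b)" by blast
    then show "s r x \<in> ?W"
      using R.subspace_scale[OF I]
      by (auto intro!: exI[of _ "\<lambda>b. r * g b"] simp: scale_sum_right)
  qed
  moreover have "{s r x |r x. r \<in> I \<and> x \<in> span X} \<subseteq> ?W"
  proof clarify
    fix r x assume r: "r \<in> I" and "x \<in> span X"
    then obtain u where "x = (\<Sum>b\<in>X. s (u b) b)"
      using span_finite[OF X] by auto
    then have "s r x = (\<Sum>b\<in>X. s (u b * r) b)"
      by (simp add: scale_sum_right mult.commute)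
    moreover have "\<forall>b\<in>X. u b * r \<in> I" using R.subspace_scale[OF I r] by blast
    ultimately show "\<exists>g. s r x = (\<Sum>b\<in>X. s (g b) b) \<and> (\<forall>b\<in>X. g b \<in> I)"
      by (intro exI[of _ "\<lambda>b. u b * r"]) simp
  qed
  ultimately have "ideal_times s I (span X) \<subseteq> ?W"
    unfolding ideal_times_def by (rule span_minimal[rotated])
  then show thesis using w that by blast
qed

lemma in_ideal_times: "module s \<Longrightarrow> r \<in> I \<Longrightarrow> x \<in> N \<Longrightarrow> s r x \<in> ideal_times s I N"
  unfolding ideal_times_def by (intro module.span_base) auto

lemma subspace_ideal_times: "module s \<Longrightarrow> module.subspace s (ideal_times s I N)"
  unfolding ideal_times_def by (rule module.subspace_span)

text \<open>
  Comparing coordinates with respect to a basis of \<open>C\<close> reduces cancellation of \<open>t\<close> on \<open>C/IC\<close> to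
  cancellation on \<open>S/I\<close>.
\<close>

lemma regular_element_on_free:
  assumes s: "module s" and I: "module.subspace (*) I"
    and reg: "\<And>r. t * r \<in> I \<Longrightarrow> r \<in> I"
    and C: "fg_free s C" and z: "z \<in> C" and tz: "s t z \<in> ideal_times s I C"
  shows "z \<in> ideal_times s I C"
proof -
  interpret module s by (fact s)
  obtain X where X: "finite X" "independent X" "span X = C"
    using C unfolding fg_free_def by auto
  obtain r where r: "z = (\<Sum>b\<in>X. s (r b) b)"
    using z span_finite[OF X(1)] X(3) by auto
  obtain g where g: "\<And>b. b \<in> X \<Longrightarrow> g b \<in> I" "s t z = (\<Sum>b\<in>X. s (g b) b)"
    using ideal_times_span_finite[OF s I X(1)] tz X(3) by metis
  have "(\<Sum>b\<in>X. s (t * r b - g b) b) = 0"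
    using g(2) r by (simp add: scale_left_diff_distrib sum_subtractf scale_sum_right)
  then have "t * r b - g b = 0" if "b \<in> X" for b
    using independentD[OF X(2,1) order.refl, where u = "\<lambda>b. t * r b - g b"] that by blast
  then have "r b \<in> I" if "b \<in> X" for b
    using that g(1) reg by simp
  moreover have "b \<in> C" if "b \<in> X" for b
    using that X(3) span_base by blast
  ultimately show ?thesis
    unfolding r using in_ideal_times[OF s]
    by (intro subspace_sum[OF subspace_ideal_times[OF s]]) blast
qed

text \<open>
  Projectivity of free modules: choose preimages of a basis and extend linearly. Drawing the
  preimages from a submodule \<open>W\<close> is what later lets one prescribe where the lift takes its values.
\<close>

lemma lift_from_free:
  assumes s: "module s" and D: "module_hom s' s D" and W: "module.subspace s' W"
    and N: "fg_free s N" and g: "module_hom s s g"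
    and onto: "g ` N \<subseteq> D ` W"
  obtains H where "linear_between s s' N W H" "\<And>a. a \<in> N \<Longrightarrow> D (H a) = g a"
proof -
  interpret D: module_hom s' s D by (fact D)
  interpret g: module_hom s s g by (fact g)
  obtain X where X: "finite X" "D.m2.independent X" "D.m2.span X = N"
    using N unfolding fg_free_def by auto
  have "\<forall>b\<in>X. \<exists>w\<in>W. D w = g b"
    using onto X(3) D.m2.span_base by fastforce
  then obtain k where k: "\<And>b. b \<in> X \<Longrightarrow> k b \<in> W" "\<And>b. b \<in> X \<Longrightarrow> D (k b) = g b"
    by metis
  let ?r = "D.m2.representation X"
  define H where "H a = (\<Sum>b\<in>X. s' (?r a b) (k b))" for a
  show thesis
  proof
    show "linear_between s s' N W H"
      unfolding linear_between_def
    proof (intro conjI ballI allI)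
      show "H ` N \<subseteq> W"
        unfolding H_def
        by (auto intro!: D.m1.subspace_sum[OF W] D.m1.subspace_scale[OF W] k(1))
      show "H (x + y) = H x + H y" if "x \<in> N" "y \<in> N" for x y
        using that X unfolding H_def
        by (simp add: D.m2.representation_add D.m1.scale_left_distrib sum.distrib)
      show "H (s r x) = s' r (H x)" if "x \<in> N" for r x
        using that X unfolding H_def
        by (simp add: D.m2.representation_scale D.m1.scale_sum_right)
    qed
    show "D (H a) = g a" if "a \<in> N" for a
    proof -
      have "D (H a) = g (\<Sum>b\<in>X. s (?r a b) b)"
        by (simp add: H_def D.sum D.scale g.sum g.scale k(2))
      then show ?thesis
        using D.m2.sum_representation_eq[OF X(2) _ X(1) order.refl] that X(3) by simp
    qed
  qed
qed


section \<open>Filtrations\<close>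

lemma direct_sum_decomp_left_subset:
  assumes "module s" "direct_sum_decomp s N N1 N2" shows "N1 \<subseteq> N"
proof -
  interpret module s by (fact assms(1))
  have "N = {x + y |x y. x \<in> N1 \<and> y \<in> N2}" "0 \<in> N2"
    using assms(2) subspace_0 unfolding direct_sum_decomp_def by blast+
  then show ?thesis by force
qed

lemma direct_sum_decomp_right_subset:
  assumes "module s" "direct_sum_decomp s N N1 N2" shows "N2 \<subseteq> N"
proof -
  interpret module s by (fact assms(1))
  have "N = {x + y |x y. x \<in> N1 \<and> y \<in> N2}" "0 \<in> N1"
    using assms(2) subspace_0 unfolding direct_sum_decomp_def by blast+
  then show ?thesis by force
qed

lemma free_filtration_subspace:
  "module s \<Longrightarrow> free_filtration s c A \<Longrightarrow> p \<le> c \<Longrightarrow> module.subspace s (A p)"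
  using fg_free_subspace unfolding free_filtration_def by blast

lemma free_filtration_mono:
  assumes "module s" "free_filtration s c A" "p \<le> q" "q \<le> c"
  shows "A p \<subseteq> A q"
  using assms(3,4)
proof (induction q rule: dec_induct)
  case (step n)
  then have "Suc n \<in> {1..c}" by simp
  then obtain C where "direct_sum_decomp s (A (Suc n)) (A (Suc n - 1)) C"
    using assms(2) unfolding free_filtration_def by blast
  then have "A n \<subseteq> A (Suc n)"
    using direct_sum_decomp_left_subset[OF assms(1)] by fastforce
  then show ?case using step by auto
qed simp

lemma dsum_single:
  "p \<in> {1..c} \<Longrightarrow> a \<in> A p \<Longrightarrow> (\<And>q. q \<in> {1..c} \<Longrightarrow> 0 \<in> A q) \<Longrightarrow> 0(p := a) \<in> dsum c A"
  unfolding dsum_def by auto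

text \<open>Minimality is passed from one \<open>h\<close> to another through this submodule.\<close>

lemma subspace_image_dsum:
  assumes s0: "module s0" and s1: "module s1"
    and A: "\<And>q. q \<in> {1..c} \<Longrightarrow> module.subspace s0 (A q)"
    and h: "linear_between (fun_scale s0) s1 (dsum c A) UNIV h"
  shows "module.subspace s1 (h ` dsum c A)"
proof -
  interpret m0: module s0 by (fact s0)
  interpret m1: module s1 by (fact s1)
  note sub = A[unfolded m0.subspace_def]
  have z: "0 \<in> dsum c A" using sub by (auto simp: dsum_def)
  have add: "x + y \<in> dsum c A" if "x \<in> dsum c A" "y \<in> dsum c A" for x y
    using that sub by (auto simp: dsum_def)
  have sc: "fun_scale s0 r x \<in> dsum c A" if "x \<in> dsum c A" for r x
    using that sub by (auto simp: dsum_def fun_scale_def)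
  have hadd: "h (x + y) = h x + h y" if "x \<in> dsum c A" "y \<in> dsum c A" for x y
    using h that unfolding linear_between_def by blast
  have hsc: "h (fun_scale s0 r x) = s1 r (h x)" if "x \<in> dsum c A" for r x
    using h that unfolding linear_between_def by blast
  have "h 0 = 0" using hadd[OF z z] by simp
  then show ?thesis
    unfolding m1.subspace_def using z add sc
    by (auto simp flip: hadd hsc intro: image_eqI[OF sym])
qed

lemma hcomp_linear_between:
  assumes s0: "module s0"
    and A: "\<And>q. q \<in> {1..c} \<Longrightarrow> module.subspace s0 (A q)"
    and h: "linear_between (fun_scale s0) s1 (dsum c A) UNIV h"
    and hA: "h ` dsum p A \<subseteq> N" and p: "p \<in> {1..c}"
  shows "linear_between s0 s1 (A p) N (hcomp h p)"
proof -
  interpret m0: module s0 by (fact s0)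
  have A0: "0 \<in> A q" if "q \<in> {1..c}" for q using m0.subspace_0[OF A[OF that]] .
  have add: "0(p := x + y) = 0(p := x) + 0(p := y)" for x y :: 'b by auto
  have scale: "0(p := s0 r x) = fun_scale s0 r (0(p := x))" for r x
    by (auto simp: fun_scale_def)
  have inc: "0(p := x) \<in> dsum c A" if "x \<in> A p" for x
    using dsum_single[of p c x A] p that A0 by blast
  have inp: "0(p := x) \<in> dsum p A" if "x \<in> A p" for x
    using dsum_single[of p p x A] p that A0 by auto
  show ?thesis
    unfolding linear_between_def hcomp_def
  proof (intro conjI ballI allI)
    show "(\<lambda>a. h (0(p := a))) ` A p \<subseteq> N" using inp hA by blast
    show "h (0(p := x + y)) = h (0(p := x)) + h (0(p := y))" if "x \<in> A p" "y \<in> A p" for x y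
      unfolding add using h inc that unfolding linear_between_def by blast
    show "h (0(p := s0 r x)) = s1 r (h (0(p := x)))" if "x \<in> A p" for r x
      unfolding scale using h inc that unfolding linear_between_def by blast
  qed
qed


section \<open>The first differential\<close>

lemma module_L1_scale:
  assumes "module s0" "module s1" shows "module (L1_scale s0 s1)"
proof -
  interpret m0: module s0 by fact
  interpret m1: module s1 by fact
  show ?thesis
    by unfold_locales
      (auto simp: L1_scale_def fun_scale_def fun_eq_iff m0.scale_left_distrib
        m0.scale_right_distrib m1.scale_left_distrib m1.scale_right_distrib)
qed

lemma module_hom_L1_diff:
  assumes "module s0" "module s1" "module_hom s1 s0 d"
  shows "module_hom (L1_scale s0 s1) s0 (L1_diff f s0 d p)"
proof -
  interpret d: module_hom s1 s0 d by fact
  interpret L: module "L1_scale s0 s1" by (rule module_L1_scale) fact+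
  show ?thesis
    by unfold_locales
      (auto simp: L1_scale_def L1_diff_def fun_scale_def d.add d.scale d.m2.scale_right_distrib
        sum.distrib d.m2.scale_sum_right mult.commute)
qed

lemma subspace_L1_carrier:
  assumes s0: "module s0" and s1: "module s1"
    and A1: "module.subspace s1 (A1 p)" and J: "module.subspace s1 J"
    and B0: "\<And>q. q \<in> {1..p} \<Longrightarrow> module.subspace s0 (B0 q)"
  shows "module.subspace (L1_scale s0 s1) {w \<in> L1_carrier A1 B0 p. fst w \<in> J}"
proof -
  interpret m0: module s0 by fact
  interpret m1: module s1 by fact
  interpret L: module "L1_scale s0 s1" by (rule module_L1_scale) fact+
  note A1' = A1[unfolded m1.subspace_def] and J' = J[unfolded m1.subspace_def]
  have B0': "0 \<in> B0 q \<and> (\<forall>x\<in>B0 q. \<forall>y\<in>B0 q. x + y \<in> B0 q) \<and> (\<forall>r. \<forall>x\<in>B0 q. s0 r x \<in> B0 q)"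
    if "1 \<le> i" "i < q" "q \<le> p" for i q
    using B0[of q, unfolded m0.subspace_def] that by simp
  show ?thesis
    unfolding L.subspace_def L1_carrier_def L1_scale_def fun_scale_def
    using A1' J' B0' by (auto simp: zero_prod_def split: if_splits)
qed

text \<open>
  Every summand \<open>e\<^sub>i B\<^sub>0(q)\<close> of \<open>L(p)\<^sub>1\<close> has \<open>i < q \<le> p\<close>, so modulo \<open>I\<^sub>p\<^sub>-\<^sub>1\<close> the differential is \<open>d\<close>.
  This is how a homotopy for \<open>f\<^sub>p\<close> yields \<open>d h\<^sub>p \<equiv> f\<^sub>p\<close>.
\<close>

lemma L1_diff_in_ideal:
  assumes s0: "module s0" and ff: "free_filtration s0 c A0" and sp: "splitting s0 c A0 B0"
    and p: "p \<in> {1..c}" and w: "(x, u) \<in> L1_carrier A1 B0 p"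
  shows "L1_diff f s0 d p (x, u) - d x \<in> ideal_times s0 (seq_ideal f (p - 1)) (A0 p)"
proof -
  interpret module s0 by fact
  interpret R: module "(*) :: 'a \<Rightarrow> 'a \<Rightarrow> 'a" by (fact module_mult)
  have "s0 (f i) (u (i, q)) \<in> ideal_times s0 (seq_ideal f (p - 1)) (A0 p)"
    if q: "q \<in> {1..p}" and i: "i \<in> {1..<q}" for q i
  proof (intro in_ideal_times[OF s0])
    show "f i \<in> seq_ideal f (p - 1)"
      unfolding seq_ideal_def using q i by (intro R.span_base) auto
    have "u (i, q) \<in> B0 q"
    proof -
      have "if 1 \<le> i \<and> i < q \<and> q \<le> p then u (i, q) \<in> B0 q else u (i, q) = 0"
        using w unfolding L1_carrier_def by blast
      then show ?thesis using q i by simp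
    qed
    moreover have "B0 q \<subseteq> A0 q"
      using direct_sum_decomp_right_subset[OF s0] sp p q unfolding splitting_def
      by (meson atLeastAtMost_iff order_trans)
    moreover have "A0 q \<subseteq> A0 p"
      using free_filtration_mono[OF s0 ff] p q by simp
    ultimately show "u (i, q) \<in> A0 p" by blast
  qed
  then show ?thesis
    unfolding L1_diff_def
    by (auto intro!: subspace_sum[OF subspace_ideal_times[OF s0]])
qed

text \<open>
  These elements have component \<open>0\<close> in \<open>A\<^sub>1(p)\<close>, so the multiples \<open>f\<^sub>i B\<^sub>0(p)\<close> with \<open>i < p\<close> are
  reached without any contribution to \<open>h\<close>.
\<close>

lemma L1_diff_Koszul_summand:
  assumes s0: "module s0" and d: "d 0 = 0" and i: "i \<in> {1..<p}"
  shows "L1_diff f s0 d p (0, 0((i, p) := b)) = s0 (f i) b"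
proof -
  interpret module s0 by fact
  have "(\<Sum>j=1..<q. s0 (f j) ((0((i, p) := b)) (j, q))) = (if q = p then s0 (f i) b else 0)" for q
  proof (cases "q = p")
    case True
    have "(\<Sum>j=1..<p. s0 (f j) ((0((i, p) := b)) (j, p))) = (\<Sum>j=1..<p. if j = i then s0 (f i) b else 0)"
      by (intro sum.cong) auto
    then show ?thesis using True i by simp
  qed simp
  then have "L1_diff f s0 d p (0, 0((i, p) := b)) = (\<Sum>q=1..p. if q = p then s0 (f i) b else 0)"
    by (simp add: L1_diff_def d)
  then show ?thesis using i by simp
qed

lemma L1_diff_Suc:
  assumes s0: "module s0" and "(x, u) \<in> L1_carrier A1 B0 p"
  shows "L1_diff f s0 d (Suc p) (x, u) = L1_diff f s0 d p (x, u)"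
proof -
  interpret module s0 by fact
  have "\<forall>i. u (i, Suc p) = 0"
  proof
    fix i
    have "if 1 \<le> i \<and> i < Suc p \<and> Suc p \<le> p then u (i, Suc p) \<in> B0 (Suc p) else u (i, Suc p) = 0"
      using assms(2) unfolding L1_carrier_def by blast
    then show "u (i, Suc p) = 0" by simp
  qed
  then show ?thesis by (simp add: L1_diff_def)
qed

lemma L1_carrier_Suc:
  assumes "A1 p \<subseteq> A1 (Suc p)" "0 \<in> B0 (Suc p)"
  shows "L1_carrier A1 B0 p \<subseteq> L1_carrier A1 B0 (Suc p)"
proof clarify
  fix x u assume w: "(x, u) \<in> L1_carrier A1 B0 p"
  have u: "if 1 \<le> i \<and> i < q \<and> q \<le> p then u (i, q) \<in> B0 q else u (i, q) = 0" for i q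
    using w unfolding L1_carrier_def by blast
  have "if 1 \<le> i \<and> i < q \<and> q \<le> Suc p then u (i, q) \<in> B0 q else u (i, q) = 0" for i q
    using u[of i q] assms(2) by (cases "q = Suc p") (auto split: if_splits)
  moreover have "x \<in> A1 (Suc p)" using w assms(1) unfolding L1_carrier_def by blast
  ultimately show "(x, u) \<in> L1_carrier A1 B0 (Suc p)" unfolding L1_carrier_def by blast
qed


section \<open>Strong matrix factorizations are higher matrix factorizations\<close>

text \<open>
  This is the trace of the exactness of \<open>\<^bold>L(p)\<close> in degree 1 on the component \<open>B\<^sub>1(p)\<close>. It holds
  because \<open>h\<^sub>p\<close> carries \<open>d x\<close> into \<open>I\<^sub>p\<^sub>-\<^sub>1 A\<^sub>1(p)\<close>, while it also carries it to \<open>f\<^sub>p x\<close> up to the allowed error;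
  regularity then cancels \<open>f\<^sub>p\<close> on the complement \<open>C\<close> that represents \<open>B\<^sub>1(p)\<close>.
\<close>

lemma boundary_in_ideal_imp_in_ideal:
  assumes hmf: "higher_matrix_factorization f c s0 s1 A0 A1 d h"
    and reg: "regular_sequence f c" and p: "p \<in> {1..c}" and x: "x \<in> A1 p"
    and dx: "d x \<in> ideal_times s0 (seq_ideal f (p - 1)) (A0 p)"
  shows "x \<in> {y + z |y z. y \<in> A1 (p - 1) \<and> z \<in> ideal_times s1 (seq_ideal f (p - 1)) (A1 p)}"
proof -
  let ?I = "seq_ideal f (p - 1)"
  have fd: "factorization_data c s0 s1 A0 A1 d h"
    using hmf unfolding higher_matrix_factorization_def by blast
  have s0: "module s0" and s1: "module s1" and F0: "free_filtration s0 c A0"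
    and F1: "free_filtration s1 c A1"
    using fd unfolding factorization_data_def by blast+
  interpret m0: module s0 by (fact s0)
  interpret m1: module s1 by (fact s1)
  interpret R: module "(*) :: 'a \<Rightarrow> 'a \<Rightarrow> 'a" by (fact module_mult)
  have I: "R.subspace ?I" unfolding seq_ideal_def by (rule R.subspace_span)
  have A1p: "m1.subspace (A1 (p - 1))" "m1.subspace (A1 p)" and A0p: "m0.subspace (A0 p)"
    using free_filtration_subspace[OF s1 F1] free_filtration_subspace[OF s0 F0] p by auto
  obtain C where C: "fg_free s1 C" and dec: "direct_sum_decomp s1 (A1 p) (A1 (p - 1)) C"
    using F1 p unfolding free_filtration_def by blast
  have Csub: "m1.subspace C" by (rule fg_free_subspace[OF s1 C])
  have A1eq: "A1 p = {y + z |y z. y \<in> A1 (p - 1) \<and> z \<in> C}" and disj: "A1 (p - 1) \<inter> C = {0}"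
    using dec unfolding direct_sum_decomp_def by blast+
  have CA: "C \<subseteq> A1 p" by (rule direct_sum_decomp_right_subset[OF s1 dec])
  let ?IC = "ideal_times s1 ?I C"
  have IC: "m1.subspace ?IC" by (rule subspace_ideal_times[OF s1])
  have IC_C: "?IC \<subseteq> C"
    using m1.subspace_scale[OF Csub] unfolding ideal_times_def
    by (intro m1.span_minimal Csub) auto
  let ?E = "{y + z |y z. y \<in> A1 (p - 1) \<and> z \<in> ?IC}"
  have E: "m1.subspace ?E"
    using m1.subspace_span[of "A1 (p - 1) \<union> ?IC"]
    unfolding m1.span_Un m1.span_eq_iff[THEN iffD2, OF A1p(1)] m1.span_eq_iff[THEN iffD2, OF IC] .
  have IA_E: "ideal_times s1 ?I (A1 p) \<subseteq> ?E"
    unfolding ideal_times_def[of s1 ?I "A1 p"]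
  proof (intro m1.span_minimal[OF _ E], clarify)
    fix r a assume r: "r \<in> ?I" and "a \<in> A1 p"
    then obtain y z where "a = y + z" "y \<in> A1 (p - 1)" "z \<in> C" using A1eq by blast
    then show "\<exists>y z. s1 r a = y + z \<and> y \<in> A1 (p - 1) \<and> z \<in> ?IC"
      using m1.subspace_scale[OF A1p(1)] in_ideal_times[OF s1 r, of z C]
      by (metis m1.scale_right_distrib)
  qed
  have EA: "A1 (p - 1) \<subseteq> ?E" using m1.subspace_0[OF IC] by force
  have hlin: "linear_between s0 s1 (A0 p) (A1 p) (hcomp h p)"
    using fd p free_filtration_subspace[OF s0 F0] unfolding factorization_data_def
    by (intro hcomp_linear_between[OF s0, of c]) auto
  have "hcomp h p (d x) \<in> ?E"
  proof -
    let ?P = "{a \<in> A0 p. hcomp h p a \<in> ideal_times s1 ?I (A1 p)}"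
    have hadd: "hcomp h p (a + b) = hcomp h p a + hcomp h p b" if "a \<in> A0 p" "b \<in> A0 p" for a b
      using hlin that unfolding linear_between_def by blast
    have hsc: "hcomp h p (s0 r a) = s1 r (hcomp h p a)" if "a \<in> A0 p" for r a
      using hlin that unfolding linear_between_def by blast
    have h0: "hcomp h p 0 = 0"
      using hadd[OF m0.subspace_0[OF A0p] m0.subspace_0[OF A0p]] by simp
    note IA = subspace_ideal_times[OF s1, of ?I "A1 p"]
    have "m0.subspace ?P"
      unfolding m0.subspace_def
      using m0.subspace_0[OF A0p] m0.subspace_add[OF A0p] m0.subspace_scale[OF A0p]
        m1.subspace_0[OF IA] m1.subspace_add[OF IA] m1.subspace_scale[OF IA] hadd hsc h0
      by auto
    moreover have "{s0 r a |r a. r \<in> ?I \<and> a \<in> A0 p} \<subseteq> ?P"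
    proof clarify
      fix r a assume r: "r \<in> ?I" and a: "a \<in> A0 p"
      have "hcomp h p a \<in> A1 p" using hlin a unfolding linear_between_def by blast
      then show "s0 r a \<in> A0 p \<and> hcomp h p (s0 r a) \<in> ideal_times s1 ?I (A1 p)"
        using m0.subspace_scale[OF A0p a] hsc[OF a] in_ideal_times[OF s1 r] by simp
    qed
    ultimately have "ideal_times s0 ?I (A0 p) \<subseteq> ?P"
      unfolding ideal_times_def by (rule m0.span_minimal[rotated])
    then show ?thesis using dx IA_E by blast
  qed
  moreover have "hcomp h p (d x) - s1 (f p) x \<in> ?E"
  proof -
    obtain y z where yz: "hcomp h p (d x) - s1 (f p) x = y + z" "y \<in> A1 (p - 1)"
      "z \<in> ideal_times s1 ?I (A1 p)"
      using hmf p x unfolding higher_matrix_factorization_def by blast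
    show ?thesis
      unfolding yz(1) by (rule m1.subspace_add[OF E subsetD[OF EA yz(2)] subsetD[OF IA_E yz(3)]])
  qed
  ultimately have "hcomp h p (d x) - (hcomp h p (d x) - s1 (f p) x) \<in> ?E"
    by (rule m1.subspace_diff[OF E])
  then have "s1 (f p) x \<in> ?E" by (simp only: diff_diff_eq2 add_diff_cancel_left')
  then obtain y' z' where 1: "s1 (f p) x = y' + z'" "y' \<in> A1 (p - 1)" "z' \<in> ?IC" by blast
  obtain y z where 2: "x = y + z" "y \<in> A1 (p - 1)" "z \<in> C" using x A1eq by blast
  \<comment> \<open>Compare the components of \<open>f\<^sub>p x\<close> in \<open>C\<close>.\<close>
  have "s1 (f p) z - z' = y' - s1 (f p) y"
    using 1(1) unfolding 2(1) m1.scale_right_distrib by (simp add: algebra_simps)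
  moreover have "y' - s1 (f p) y \<in> A1 (p - 1)"
    by (intro m1.subspace_diff m1.subspace_scale A1p 1 2)
  moreover have "s1 (f p) z - z' \<in> C"
    using IC_C 1(3) by (intro m1.subspace_diff m1.subspace_scale Csub 2) auto
  ultimately have "s1 (f p) z - z' = 0" using disj by (metis IntI singletonD)
  then have "s1 (f p) z \<in> ?IC" using 1(3) by simp
  moreover have "\<And>r. f p * r \<in> ?I \<Longrightarrow> r \<in> ?I"
    using reg p unfolding regular_sequence_def by blast
  ultimately have "z \<in> ?IC"
    using regular_element_on_free[OF s1 I _ C 2(3)] by blast
  moreover have "?IC \<subseteq> ideal_times s1 ?I (A1 p)"
    unfolding ideal_times_def using CA by (intro m1.span_mono) blast
  ultimately show ?thesis using 2 by blast
qed

lemma strong_imp_higher_matrix_factorization: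
  assumes reg: "regular_sequence f c" and sp: "splitting s0 c A0 B0"
    and strong: "strong_matrix_factorization f c s0 s1 A0 A1 B0 d h"
  shows "higher_matrix_factorization f c s0 s1 A0 A1 d h"
proof -
  have fd: "factorization_data c s0 s1 A0 A1 d h"
    using strong unfolding strong_matrix_factorization_def by blast
  obtain h' where h': "higher_matrix_factorization f c s0 s1 A0 A1 d h'"
    using strong unfolding strong_matrix_factorization_def by blast
  have s0: "module s0" and s1: "module s1" and F0: "free_filtration s0 c A0"
    and F1: "free_filtration s1 c A1" and d: "module_hom s1 s0 d"
    and dA: "\<And>p. p \<le> c \<Longrightarrow> d ` A1 p \<subseteq> A0 p"
    using fd unfolding factorization_data_def by blast+
  interpret d: module_hom s1 s0 d by (fact d)
  show ?thesis
    unfolding higher_matrix_factorization_def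
  proof (intro conjI ballI fd)
    fix p assume p: "p \<in> {1..c}"
    let ?IA = "ideal_times s0 (seq_ideal f (p - 1)) (A0 p)"
    obtain H where H: "linear_between s0 (L1_scale s0 s1) (A0 p) (L1_carrier A1 B0 p) H"
      "\<And>a. a \<in> A0 p \<Longrightarrow> fst (H a) = hcomp h p a \<and> L1_diff f s0 d p (H a) = s0 (f p) a"
      using strong p unfolding strong_matrix_factorization_def by metis
    have Hc: "H a \<in> L1_carrier A1 B0 p" if "a \<in> A0 p" for a
      using H(1) that unfolding linear_between_def by blast
    show 1: "d (hcomp h p a) - s0 (f p) a \<in> ?IA" if a: "a \<in> A0 p" for a
    proof -
      obtain x u where xu: "H a = (x, u)" by fastforce
      have "s0 (f p) a - d (hcomp h p a) \<in> ?IA"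
        using L1_diff_in_ideal[OF s0 F0 sp p Hc[OF a, unfolded xu], of f d] H(2)[OF a]
        unfolding xu by simp
      from d.m2.subspace_neg[OF subspace_ideal_times[OF s0] this] show ?thesis by simp
    qed
    fix x assume x: "x \<in> A1 p"
    let ?y = "hcomp h p (d x) - s1 (f p) x"
    have dx: "d x \<in> A0 p" using dA p x by fastforce
    have "hcomp h p (d x) \<in> A1 p"
      using Hc[OF dx] H(2)[OF dx] unfolding L1_carrier_def by auto
    moreover have "d.m1.subspace (A1 p)"
      using free_filtration_subspace[OF s1 F1] p by simp
    ultimately have "?y \<in> A1 p"
      using x by (intro d.m1.subspace_diff d.m1.subspace_scale)
    moreover have "d ?y \<in> ?IA"
      using 1[OF dx] by (simp add: d.diff d.scale)
    ultimately show "?y \<in> {y + z |y z. y \<in> A1 (p - 1) \<and>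
        z \<in> ideal_times s1 (seq_ideal f (p - 1)) (A1 p)}"
      by (rule boundary_in_ideal_imp_in_ideal[OF h' reg p])
  qed
qed


section \<open>Existence of strong matrix factorizations\<close>

text \<open>
  The cokernel of the first differential of \<open>\<^bold>L(p)\<close> is annihilated by \<open>f\<^sub>1, \<dots>, f\<^sub>p\<close>, and this stays
  true when the component in \<open>A\<^sub>1(p)\<close> is confined to a submodule \<open>J\<close> that contains the values of \<open>h\<close>.
  The induction has to carry all the \<open>f\<^sub>i\<close> with \<open>i \<le> p\<close>: the step for \<open>f\<^sub>p\<close> needs \<open>I\<^sub>p\<^sub>-\<^sub>1 A\<^sub>0(p)\<close> to be covered.
\<close>

lemma homotopy_image_contains_multiples:
  assumes hmf: "higher_matrix_factorization f c s0 s1 A0 A1 d h"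
    and sp: "splitting s0 c A0 B0"
    and J: "module.subspace s1 J"
    and hJ: "\<And>p a. p \<in> {1..c} \<Longrightarrow> a \<in> A0 p \<Longrightarrow> hcomp h p a \<in> J"
    and "p \<le> c" "i \<in> {1..p}" "a \<in> A0 p"
  shows "s0 (f i) a \<in> L1_diff f s0 d p ` {w \<in> L1_carrier A1 B0 p. fst w \<in> J}"
  using assms(5-)
proof (induction p arbitrary: i a)
  case 0
  then show ?case by simp
next
  case (Suc p)
  have fd: "factorization_data c s0 s1 A0 A1 d h"
    using hmf unfolding higher_matrix_factorization_def by blast
  have s0: "module s0" and s1: "module s1" and F0: "free_filtration s0 c A0"
    and F1: "free_filtration s1 c A1" and d: "module_hom s1 s0 d"
    and hlin: "linear_between (fun_scale s0) s1 (dsum c A0) UNIV h"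
    and hA: "\<And>p. p \<le> c \<Longrightarrow> h ` dsum p A0 \<subseteq> A1 p"
    using fd unfolding factorization_data_def by blast+
  interpret d: module_hom s1 s0 d by (fact d)
  let ?V = "\<lambda>p. {w \<in> L1_carrier A1 B0 p. fst w \<in> J}"
  let ?N = "\<lambda>p. L1_diff f s0 d p ` ?V p"
  have p': "Suc p \<in> {1..c}" using Suc.prems by simp
  have B0: "d.m2.subspace (B0 q)" if "q \<in> {1..c}" for q
    using sp that unfolding splitting_def direct_sum_decomp_def by blast
  have A1sub: "d.m1.subspace (A1 (Suc p))"
    using free_filtration_subspace[OF s1 F1] p' by simp
  interpret D: module_hom "L1_scale s0 s1" s0 "L1_diff f s0 d (Suc p)"
    by (rule module_hom_L1_diff[OF s0 s1 d])
  have "D.m1.subspace (?V (Suc p))"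
    using B0 p' by (intro subspace_L1_carrier[of s0 s1 A1 "Suc p" J B0, OF s0 s1 A1sub J]) auto
  then have N: "d.m2.subspace (?N (Suc p))"
    by (rule D.subspace_image)
  have dec: "direct_sum_decomp s0 (A0 (Suc p)) (A0 p) (B0 (Suc p))"
    using sp p' unfolding splitting_def by (metis diff_Suc_1)
  have mono: "?N p \<subseteq> ?N (Suc p)"
  proof
    fix b assume "b \<in> ?N p"
    then obtain x u where w: "(x, u) \<in> L1_carrier A1 B0 p" "x \<in> J" "b = L1_diff f s0 d p (x, u)"
      by auto
    have "A1 p \<subseteq> A1 (Suc p)" using free_filtration_mono[OF s1 F1] p' by simp
    then have "(x, u) \<in> ?V (Suc p)"
      using L1_carrier_Suc[of A1 p B0] d.m2.subspace_0[OF B0[OF p']] w by auto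
    then show "b \<in> ?N (Suc p)"
      unfolding w(3) L1_diff_Suc[OF s0 w(1), of f d, symmetric] by (rule imageI)
  qed
  have small: "s0 (f j) b \<in> ?N (Suc p)" if j: "j \<in> {1..p}" and b: "b \<in> A0 (Suc p)" for j b
  proof -
    obtain y z where yz: "b = y + z" "y \<in> A0 p" "z \<in> B0 (Suc p)"
      using b dec unfolding direct_sum_decomp_def by blast
    have "s0 (f j) y \<in> ?N (Suc p)"
      using Suc.IH[OF _ j yz(2)] mono p' by auto
    moreover have "s0 (f j) z \<in> ?N (Suc p)"
    proof (rule image_eqI)
      show "s0 (f j) z = L1_diff f s0 d (Suc p) (0, 0((j, Suc p) := z))"
        using L1_diff_Koszul_summand[of s0 d j "Suc p" f z] s0 d.zero j by simp
      have "0 \<in> B0 q" if "1 \<le> q" "q \<le> Suc p" for q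
        using d.m2.subspace_0[OF B0] that p' by simp
      then show "(0, 0((j, Suc p) := z)) \<in> ?V (Suc p)"
        using j yz(3) d.m1.subspace_0[OF A1sub] d.m1.subspace_0[OF J]
        unfolding L1_carrier_def by auto
    qed
    ultimately show ?thesis
      using d.m2.subspace_add[OF N] by (simp add: yz(1) d.m2.scale_right_distrib)
  qed
  show ?case
  proof (cases "i = Suc p")
    case False
    then show ?thesis using small Suc.prems by simp
  next
    case True
    have incl: "ideal_times s0 (seq_ideal f p) (A0 (Suc p)) \<subseteq> ?N (Suc p)"
      using small by (intro ideal_times_seq_ideal_least[OF s0 N])
    have "d (hcomp h (Suc p) a) - s0 (f (Suc p)) a
        \<in> ideal_times s0 (seq_ideal f (Suc p - 1)) (A0 (Suc p))"
      using hmf p' Suc.prems(3) unfolding higher_matrix_factorization_def by blast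
    then have "d (hcomp h (Suc p) a) - s0 (f (Suc p)) a \<in> ?N (Suc p)"
      unfolding diff_Suc_1 by (rule subsetD[OF incl])
    moreover have "d (hcomp h (Suc p) a) \<in> ?N (Suc p)"
    proof (rule image_eqI)
      show "d (hcomp h (Suc p) a) = L1_diff f s0 d (Suc p) (hcomp h (Suc p) a, 0)"
        by (simp add: L1_diff_def)
      have "linear_between s0 s1 (A0 (Suc p)) (A1 (Suc p)) (hcomp h (Suc p))"
        using free_filtration_subspace[OF s0 F0] hA p'
        by (intro hcomp_linear_between[OF s0 _ hlin]) auto
      then have "hcomp h (Suc p) a \<in> A1 (Suc p)"
        using Suc.prems(3) unfolding linear_between_def by blast
      moreover have "0 \<in> B0 q" if "1 \<le> q" "q \<le> Suc p" for q
        using d.m2.subspace_0[OF B0] that p' by simp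
      ultimately show "(hcomp h (Suc p) a, 0) \<in> ?V (Suc p)"
        using hJ[OF p' Suc.prems(3)] unfolding L1_carrier_def by auto
    qed
    ultimately have "d (hcomp h (Suc p) a) - (d (hcomp h (Suc p) a) - s0 (f (Suc p)) a) \<in> ?N (Suc p)"
      by (rule d.m2.subspace_diff[OF N, rotated])
    then show ?thesis by (simp only: True diff_diff_eq2 add_diff_cancel_left')
  qed
qed

text \<open>
  Lift \<open>f\<^sub>p\<close> separately on each free module \<open>A\<^sub>0(p)\<close> with \<open>J = im h'\<close>, and assemble the \<open>A\<^sub>1\<close>-components.
  Controlling the image of \<open>h\<close> serves every ideal \<open>m\<close> at once when minimality is at issue.
\<close>

lemma strong_matrix_factorization_exists:
  assumes hmf: "higher_matrix_factorization f c s0 s1 A0 A1 d h'"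
    and sp: "splitting s0 c A0 B0"
  obtains h where "strong_matrix_factorization f c s0 s1 A0 A1 B0 d h"
    "h ` dsum c A0 \<subseteq> h' ` dsum c A0"
proof -
  have fd: "factorization_data c s0 s1 A0 A1 d h'"
    using hmf unfolding higher_matrix_factorization_def by blast
  have s0: "module s0" and s1: "module s1" and F0: "free_filtration s0 c A0"
    and F1: "free_filtration s1 c A1" and d: "module_hom s1 s0 d"
    and hlin: "linear_between (fun_scale s0) s1 (dsum c A0) UNIV h'"
    using fd unfolding factorization_data_def by blast+
  interpret m0: module s0 by (fact s0)
  interpret m1: module s1 by (fact s1)
  let ?J = "h' ` dsum c A0"
  let ?V = "\<lambda>p. {w \<in> L1_carrier A1 B0 p. fst w \<in> ?J}"
  have A0: "m0.subspace (A0 q)" if "q \<le> c" for q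
    by (rule free_filtration_subspace[OF s0 F0 that])
  have J: "m1.subspace ?J"
    using A0 by (intro subspace_image_dsum[OF s0 s1 _ hlin]) auto
  have hJ: "hcomp h' p a \<in> ?J" if "p \<in> {1..c}" "a \<in> A0 p" for p a
    unfolding hcomp_def using m0.subspace_0[OF A0] that
    by (intro imageI dsum_single) auto
  have "\<exists>H. linear_between s0 (L1_scale s0 s1) (A0 p) (?V p) H \<and>
      (\<forall>a\<in>A0 p. L1_diff f s0 d p (H a) = s0 (f p) a)" if p: "p \<in> {1..c}" for p
  proof -
    have g: "module_hom s0 s0 (s0 (f p))"
      by unfold_locales (simp_all add: m0.scale_right_distrib mult.commute)
    have V: "module.subspace (L1_scale s0 s1) (?V p)"
      using sp p free_filtration_subspace[OF s1 F1]
      unfolding splitting_def direct_sum_decomp_def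
      by (intro subspace_L1_carrier[OF s0 s1 _ J]) auto
    have onto: "s0 (f p) ` A0 p \<subseteq> L1_diff f s0 d p ` ?V p"
      using p by (intro image_subsetI
        homotopy_image_contains_multiples[OF hmf sp J hJ]) auto
    have free: "fg_free s0 (A0 p)" using F0 p unfolding free_filtration_def by simp
    show ?thesis
      by (rule lift_from_free[OF s0 module_hom_L1_diff[OF s0 s1 d] V free g onto]) blast
  qed
  then have "\<exists>H. \<forall>p\<in>{1..c}. linear_between s0 (L1_scale s0 s1) (A0 p) (?V p) (H p) \<and>
      (\<forall>a\<in>A0 p. L1_diff f s0 d p (H p a) = s0 (f p) a)"
    by (intro bchoice ballI)
  then obtain H where
    H: "\<And>p. p \<in> {1..c} \<Longrightarrow> linear_between s0 (L1_scale s0 s1) (A0 p) (?V p) (H p)"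
    and diffH: "\<And>p a. p \<in> {1..c} \<Longrightarrow> a \<in> A0 p \<Longrightarrow> L1_diff f s0 d p (H p a) = s0 (f p) a"
    by blast
  have Hadd: "H p (a + b) = H p a + H p b" if "p \<in> {1..c}" "a \<in> A0 p" "b \<in> A0 p" for p a b
    using H that unfolding linear_between_def by blast
  have Hsc: "fst (H p (s0 r a)) = s1 r (fst (H p a))" if "p \<in> {1..c}" "a \<in> A0 p" for p r a
  proof -
    have "H p (s0 r a) = L1_scale s0 s1 r (H p a)"
      using H that unfolding linear_between_def by blast
    then show ?thesis by (simp add: L1_scale_def split: prod.split)
  qed
  have HV: "H p a \<in> ?V p" if "p \<in> {1..c}" "a \<in> A0 p" for p a
    using H that unfolding linear_between_def by blast
  have H0: "H p 0 = 0" if "p \<in> {1..c}" for p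
    using Hadd[OF that, of 0 0] m0.subspace_0[OF A0] that by simp
  define h where "h v = (\<Sum>q=1..c. fst (H q (v q)))" for v
  have hc: "hcomp h p a = fst (H p a)" if p: "p \<in> {1..c}" for p a
  proof -
    have "hcomp h p a = (\<Sum>q=1..c. if q = p then fst (H p a) else 0)"
      unfolding hcomp_def h_def by (intro sum.cong) (auto simp: H0)
    then show ?thesis using p by simp
  qed
  have "linear_between (fun_scale s0) s1 (dsum c A0) UNIV h"
    unfolding linear_between_def h_def
    by (auto simp: dsum_def fun_scale_def Hadd Hsc sum.distrib m1.scale_sum_right intro!: sum.cong)
  moreover have "h ` dsum p A0 \<subseteq> A1 p" if p: "p \<le> c" for p
  proof (rule image_subsetI)
    fix v assume v: "v \<in> dsum p A0"
    have A1p: "m1.subspace (A1 p)" by (rule free_filtration_subspace[OF s1 F1 p])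
    have "fst (H q (v q)) \<in> A1 p" if q: "q \<in> {1..c}" for q
    proof (cases "q \<le> p")
      case True
      then have "v q \<in> A0 q" using v q unfolding dsum_def by auto
      then have "fst (H q (v q)) \<in> A1 q" using HV[OF q] unfolding L1_carrier_def by fastforce
      then show ?thesis using free_filtration_mono[OF s1 F1 True p] by blast
    next
      case False
      then have "v q = 0" using v unfolding dsum_def by auto
      then show ?thesis using H0[OF q] m1.subspace_0[OF A1p] by simp
    qed
    then show "h v \<in> A1 p" unfolding h_def by (intro m1.subspace_sum[OF A1p])
  qed
  ultimately have fdh: "factorization_data c s0 s1 A0 A1 d h"
    using fd unfolding factorization_data_def by blast
  show thesis
  proof (rule that)
    show "strong_matrix_factorization f c s0 s1 A0 A1 B0 d h"
      unfolding strong_matrix_factorization_def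
    proof (intro conjI ballI fdh)
      show "\<exists>h'. higher_matrix_factorization f c s0 s1 A0 A1 d h'" using hmf by blast
      fix p assume p: "p \<in> {1..c}"
      have "linear_between s0 (L1_scale s0 s1) (A0 p) (L1_carrier A1 B0 p) (H p)"
        using H[OF p] unfolding linear_between_def by blast
      then show "\<exists>H. linear_between s0 (L1_scale s0 s1) (A0 p) (L1_carrier A1 B0 p) H \<and>
          (\<forall>a\<in>A0 p. fst (H a) = hcomp h p a \<and> L1_diff f s0 d p (H a) = s0 (f p) a)"
        using diffH[OF p] hc[OF p] by (intro exI[of _ "H p"]) auto
    qed
    show "h ` dsum c A0 \<subseteq> ?J"
    proof (rule image_subsetI)
      fix v assume "v \<in> dsum c A0"
      then have "v q \<in> A0 q" if "q \<in> {1..c}" for q using that unfolding dsum_def by blast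
      then show "h v \<in> ?J"
        using HV unfolding h_def by (intro m1.subspace_sum[OF J]) blast
    qed
  qed
qed

theorem theorem14p2:
  fixes f :: "nat \<Rightarrow> 's::comm_ring_1" and c :: nat
    and s0 :: "'s \<Rightarrow> 'a::ab_group_add \<Rightarrow> 'a" and s1 :: "'s \<Rightarrow> 'b::ab_group_add \<Rightarrow> 'b"
    and A0 B0 :: "nat \<Rightarrow> 'a set" and A1 :: "nat \<Rightarrow> 'b set"
    and d :: "'b \<Rightarrow> 'a"
  assumes "noetherian_ring TYPE('s)"
    and "regular_sequence f c"
    and "splitting s0 c A0 B0"
  shows "(\<forall>h. strong_matrix_factorization f c s0 s1 A0 A1 B0 d h \<longrightarrow>
              higher_matrix_factorization f c s0 s1 A0 A1 d h) \<and>
         (\<forall>h'. higher_matrix_factorization f c s0 s1 A0 A1 d h' \<longrightarrow>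
              (\<exists>h. strong_matrix_factorization f c s0 s1 A0 A1 B0 d h \<and>
                   (\<forall>m. local_ring m \<and> minimal_factorization m c s0 s1 A0 d h' \<longrightarrow>
                        minimal_factorization m c s0 s1 A0 d h)))"
proof (intro conjI allI impI)
  fix h assume "strong_matrix_factorization f c s0 s1 A0 A1 B0 d h"
  then show "higher_matrix_factorization f c s0 s1 A0 A1 d h"
    by (rule strong_imp_higher_matrix_factorization[OF assms(2,3)])
next
  fix h' assume "higher_matrix_factorization f c s0 s1 A0 A1 d h'"
  then obtain h where "strong_matrix_factorization f c s0 s1 A0 A1 B0 d h"
    "h ` dsum c A0 \<subseteq> h' ` dsum c A0"
    by (rule strong_matrix_factorization_exists[OF _ assms(3)])
  then show "\<exists>h. strong_matrix_factorization f c s0 s1 A0 A1 B0 d h \<and>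
      (\<forall>m. local_ring m \<and> minimal_factorization m c s0 s1 A0 d h' \<longrightarrow>
        minimal_factorization m c s0 s1 A0 d h)"
    unfolding minimal_factorization_def by blast
qed

end
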